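(* For every closed formula $\varphi$ of $\mu\mathrm{HML}$ there is a monitor $m\in\mathrm{Mon}$ that is sound for $[\![\varphi]\!]$, accepts every finite trace that positively determines $[\![\varphi]\!]$, and rejects every finite trace that negatively determines $[\![\varphi]\!]$.
   Context: $\mathrm{Act}$ is a finite set of actions, $\mathrm{Act}^\infty=\mathrm{Act}^*\cup\mathrm{Act}^\omega$. A finite trace $s$ positively (resp. negatively) determines $P\subseteq\mathrm{Act}^\infty$ if $sf\in P$ (resp. $sf\notin P$) for all $f\in\mathrm{Act}^\infty$. Logic $\mu\mathrm{HML}$: $\varphi::=\mathsf{tt}\mid\mathsf{ff}\mid\varphi\lor\varphi\mid\varphi\land\varphi\mid\langle a\rangle\varphi\mid[a]\varphi\mid\min X.\varphi\mid\max X.\varphi\mid X$ ($a\in\mathrm{Act}$, $X$ from a countable set of variables), interpreted over $\mathrm{Act}^\infty$ w.r.t. a valuation $\sigma$ from variables to sets of traces: $[\![\mathsf{tt}]\!]=\mathrm{Act}^\infty$, $[\![\mathsf{ff}]\!]=\emptyset$, $\lor,\land$ as union/intersection, $[\![[a]\varphi,\sigma]\!]=\{f\mid f=af'\text{ implies }f'\in[\![\varphi,\sigma]\!]\}$, $[\![\langle a\rangle\varphi,\sigma]\!]=\{af\mid f\in[\![\varphi,\sigma]\!]\}$, $[\![\min X.\varphi,\sigma]\!]=\bigcap\{S\mid[\![\varphi,\sigma[X\mapsto S]]\!]\subseteq S\}$, $[\![\max X.\varphi,\sigma]\!]=\bigcup\{S\mid S\subseteq[\![\varphi,\sigma[X\mapsto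 S]]\!]\}$, $[\![X,\sigma]\!]=\sigma(X)$. Formulae are closed and guarded; $[\![\varphi]\!]$ denotes the semantics of a closed formula. Monitors $\mathrm{Mon}$ (closed terms): $m::=v\mid a.m\mid m+m\mid m\otimes m\mid m\oplus m\mid\mathrm{rec}\,x.m\mid x$, with verdicts $v\in\{\mathsf{end},\mathsf{no},\mathsf{yes}\}$. Transitions (labels $a\in\mathrm{Act}$ or $\tau$): $a.m\xrightarrow{a}m$; $v\xrightarrow{a}v$; $\mathrm{rec}\,x.m\xrightarrow{a}n$ if $m[\mathrm{rec}\,x.m/x]\xrightarrow{a}n$; $m+n\xrightarrow{a}m'$ if $m\xrightarrow{a}m'$ (and symmetrically); for $\odot\in\{\otimes,\oplus\}$: $m\odot n\xrightarrow{a}m'\odot n'$ if $m\xrightarrow{a}m'$ and $n\xrightarrow{a}n'$; $m\odot n\xrightarrow{\tau}m'\odot n$ if $m\xrightarrow{\tau}m'$ (and symmetrically); $\mathsf{end}\odot\mathsf{end}\xrightarrow{\tau}\mathsf{end}$; $\mathsf{yes}\otimes m\xrightarrow{\tau}m$, $\mathsf{no}\otimes m\xrightarrow{\tau}\mathsf{no}$, $\mathsf{no}\oplus m\xrightarrow{\tau}m$, $\mathsf{yes}\oplus m\xrightarrow{\tau}\mathsf{yes}$ (each also symmetrically). $m\overset{s}{\Rightarrow}n$ denotes a sequence of transitions whose visible labels are $s$, with arbitrary $\tau$-steps interleaved. $m$ accepts (rejects) a finite trace $s$, written $\mathrm{acc}(m,s)$ ($\mathrm{rej}(m,s)$), if $m\overset{s}{\Rightarrow}\mathsf{yes}$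 ($m\overset{s}{\Rightarrow}\mathsf{no}$); for infinite $t$, $\mathrm{acc}(m,t)$ ($\mathrm{rej}(m,t)$) if it accepts (rejects) some finite prefix of $t$. $m$ is sound for $P$ if $\mathrm{acc}(m,f)\Rightarrow f\in P$ and $\mathrm{rej}(m,f)\Rightarrow f\notin P$. *)

theory Defs
  imports "HOL-Library.Stream"
begin

text \<open>
  The alphabet of actions is the universe of a type of class \<open>finite\<close>.
\<close>

datatype 'a trace = Fin "'a list" | Inf "'a stream"

primrec tappend :: "'a list \<Rightarrow> 'a trace \<Rightarrow> 'a trace" where
  "tappend s (Fin u) = Fin (s @ u)"
| "tappend s (Inf t) = Inf (s @- t)"

abbreviation tcons :: "'a \<Rightarrow> 'a trace \<Rightarrow> 'a trace" where
  "tcons a f \<equiv> tappend [a] f"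

definition pos_determines :: "'a list \<Rightarrow> 'a trace set \<Rightarrow> bool" where
  "pos_determines s P \<longleftrightarrow> (\<forall>f. tappend s f \<in> P)"

definition neg_determines :: "'a list \<Rightarrow> 'a trace set \<Rightarrow> bool" where
  "neg_determines s P \<longleftrightarrow> (\<forall>f. tappend s f \<notin> P)"


type_synonym var = nat

datatype 'a formula =
    TT
  | FF
  | Or "'a formula" "'a formula"
  | And "'a formula" "'a formula"
  | Dia 'a "'a formula"
  | Box 'a "'a formula"
  | Min var "'a formula"
  | Max var "'a formula"
  | Var var

primrec sem :: "'a formula \<Rightarrow> (var \<Rightarrow> 'a trace set) \<Rightarrow> 'a trace set" where
  "sem TT \<sigma> = UNIV"
| "sem FF \<sigma> = {}"
| "sem (Or \<phi> \<psi>) \<sigma> = sem \<phi> \<sigma> \<union> sem \<psi> \<sigma>"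
| "sem (And \<phi> \<psi>) \<sigma> = sem \<phi> \<sigma> \<inter> sem \<psi> \<sigma>"
| "sem (Dia a \<phi>) \<sigma> = {tcons a f | f. f \<in> sem \<phi> \<sigma>}"
| "sem (Box a \<phi>) \<sigma> = {f. \<forall>f'. f = tcons a f' \<longrightarrow> f' \<in> sem \<phi> \<sigma>}"
| "sem (Min X \<phi>) \<sigma> = \<Inter> {S. sem \<phi> (\<sigma>(X := S)) \<subseteq> S}"
| "sem (Max X \<phi>) \<sigma> = \<Union> {S. S \<subseteq> sem \<phi> (\<sigma>(X := S))}"
| "sem (Var X) \<sigma> = \<sigma> X"

primrec fv :: "'a formula \<Rightarrow> var set" where
  "fv TT = {}"
| "fv FF = {}"
| "fv (Or \<phi> \<psi>) = fv \<phi> \<union> fv \<psi>"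
| "fv (And \<phi> \<psi>) = fv \<phi> \<union> fv \<psi>"
| "fv (Dia a \<phi>) = fv \<phi>"
| "fv (Box a \<phi>) = fv \<phi>"
| "fv (Min X \<phi>) = fv \<phi> - {X}"
| "fv (Max X \<phi>) = fv \<phi> - {X}"
| "fv (Var X) = {X}"

definition closed_formula :: "'a formula \<Rightarrow> bool" where
  "closed_formula \<phi> \<longleftrightarrow> fv \<phi> = {}"

text \<open>
  Variables with a free occurrence that is not in the scope of a modality.
\<close>

primrec unguarded_vars :: "'a formula \<Rightarrow> var set" where
  "unguarded_vars TT = {}"
| "unguarded_vars FF = {}"
| "unguarded_vars (Or \<phi> \<psi>) = unguarded_vars \<phi> \<union> unguarded_vars \<psi>"
| "unguarded_vars (And \<phi> \<psi>) = unguarded_vars \<phi> \<union> unguarded_vars \<psi>"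
| "unguarded_vars (Dia a \<phi>) = {}"
| "unguarded_vars (Box a \<phi>) = {}"
| "unguarded_vars (Min X \<phi>) = unguarded_vars \<phi> - {X}"
| "unguarded_vars (Max X \<phi>) = unguarded_vars \<phi> - {X}"
| "unguarded_vars (Var X) = {X}"

text \<open>
  Every occurrence of a fixpoint variable is separated from its binder by a modality.
\<close>

primrec guarded :: "'a formula \<Rightarrow> bool" where
  "guarded TT \<longleftrightarrow> True"
| "guarded FF \<longleftrightarrow> True"
| "guarded (Or \<phi> \<psi>) \<longleftrightarrow> guarded \<phi> \<and> guarded \<psi>"
| "guarded (And \<phi> \<psi>) \<longleftrightarrow> guarded \<phi> \<and> guarded \<psi>"
| "guarded (Dia a \<phi>) \<longleftrightarrow> guarded \<phi>"
| "guarded (Box a \<phi>) \<longleftrightarrow> guarded \<phi>"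
| "guarded (Min X \<phi>) \<longleftrightarrow> X \<notin> unguarded_vars \<phi> \<and> guarded \<phi>"
| "guarded (Max X \<phi>) \<longleftrightarrow> X \<notin> unguarded_vars \<phi> \<and> guarded \<phi>"
| "guarded (Var X) \<longleftrightarrow> True"

lemma sem_cong_fv:
  "(\<And>X. X \<in> fv \<phi> \<Longrightarrow> \<sigma> X = \<rho> X) \<Longrightarrow> sem \<phi> \<sigma> = sem \<phi> \<rho>"
proof (induction \<phi> arbitrary: \<sigma> \<rho>)
  case (Or \<phi> \<psi>)
  have "sem \<phi> \<sigma> = sem \<phi> \<rho>" by (rule Or.IH(1), rule Or.prems, simp)
  moreover have "sem \<psi> \<sigma> = sem \<psi> \<rho>" by (rule Or.IH(2), rule Or.prems, simp)
  ultimately show ?case by (simp only: sem.simps)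
next
  case (And \<phi> \<psi>)
  have "sem \<phi> \<sigma> = sem \<phi> \<rho>" by (rule And.IH(1), rule And.prems, simp)
  moreover have "sem \<psi> \<sigma> = sem \<psi> \<rho>" by (rule And.IH(2), rule And.prems, simp)
  ultimately show ?case by (simp only: sem.simps)
next
  case (Dia a \<phi>)
  have "sem \<phi> \<sigma> = sem \<phi> \<rho>" by (rule Dia.IH, rule Dia.prems, simp)
  then show ?case by (simp only: sem.simps)
next
  case (Box a \<phi>)
  have "sem \<phi> \<sigma> = sem \<phi> \<rho>" by (rule Box.IH, rule Box.prems, simp)
  then show ?case by (simp only: sem.simps)
next
  case (Min X \<phi>)
  have "sem \<phi> (\<sigma>(X := S)) = sem \<phi> (\<rho>(X := S))" for S
  proof (rule Min.IH)
    fix Y assume "Y \<in> fv \<phi>"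
    then show "(\<sigma>(X := S)) Y = (\<rho>(X := S)) Y" using Min.prems[of Y] by simp
  qed
  then show ?case by (simp only: sem.simps)
next
  case (Max X \<phi>)
  have "sem \<phi> (\<sigma>(X := S)) = sem \<phi> (\<rho>(X := S))" for S
  proof (rule Max.IH)
    fix Y assume "Y \<in> fv \<phi>"
    then show "(\<sigma>(X := S)) Y = (\<rho>(X := S)) Y" using Max.prems[of Y] by simp
  qed
  then show ?case by (simp only: sem.simps)
qed simp_all

text \<open>
  The choice of valuation is immaterial for closed formulae.
\<close>

definition csem :: "'a formula \<Rightarrow> 'a trace set" where
  "csem \<phi> = sem \<phi> (\<lambda>_. {})"

lemma sem_closed: "closed_formula \<phi> \<Longrightarrow> sem \<phi> \<sigma> = csem \<phi>"
  unfolding csem_def closed_formula_def by (rule sem_cong_fv) simp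


datatype verdict = End | No | Yes

datatype parop = Conj (\<open>'(\<otimes>')\<close>) | Disj (\<open>'(\<oplus>')\<close>)

datatype 'a mon =
    Verdict verdict
  | Prefix 'a "'a mon"
  | Sum "'a mon" "'a mon"
  | Par parop "'a mon" "'a mon"
  | Rec var "'a mon"
  | MVar var

primrec mon_fv :: "'a mon \<Rightarrow> var set" where
  "mon_fv (Verdict v) = {}"
| "mon_fv (Prefix a m) = mon_fv m"
| "mon_fv (Sum m n) = mon_fv m \<union> mon_fv n"
| "mon_fv (Par p m n) = mon_fv m \<union> mon_fv n"
| "mon_fv (Rec x m) = mon_fv m - {x}"
| "mon_fv (MVar x) = {x}"

definition Mon :: "'a mon set" where
  "Mon = {m. mon_fv m = {}}"

text \<open>
  \<open>msubst x k m\<close> replaces the free occurrences of \<open>x\<close> in \<open>m\<close> by \<open>k\<close>. Bound variables are not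
  renamed: on the terms in \<open>Mon\<close> the transition rules only substitute closed terms, so that
  nothing can be captured.
\<close>

primrec msubst :: "var \<Rightarrow> 'a mon \<Rightarrow> 'a mon \<Rightarrow> 'a mon" where
  "msubst x k (Verdict v) = Verdict v"
| "msubst x k (Prefix a m) = Prefix a (msubst x k m)"
| "msubst x k (Sum m n) = Sum (msubst x k m) (msubst x k n)"
| "msubst x k (Par p m n) = Par p (msubst x k m) (msubst x k n)"
| "msubst x k (Rec y m) = (if y = x then Rec y m else Rec y (msubst x k m))"
| "msubst x k (MVar y) = (if y = x then k else MVar y)"

datatype 'a label = Vis 'a | Tau

text \<open>
  The rules for verdicts, recursion and sums concern visible actions only.
\<close>

inductive step :: "'a mon \<Rightarrow> 'a label \<Rightarrow> 'a mon \<Rightarrow> bool" where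
  prefix: "step (Prefix a m) (Vis a) m"
| verdict: "step (Verdict v) (Vis a) (Verdict v)"
| "rec": "step (msubst x (Rec x m) m) (Vis a) n \<Longrightarrow> step (Rec x m) (Vis a) n"
| sumL: "step m (Vis a) m' \<Longrightarrow> step (Sum m n) (Vis a) m'"
| sumR: "step n (Vis a) n' \<Longrightarrow> step (Sum m n) (Vis a) n'"
| par: "step m (Vis a) m' \<Longrightarrow> step n (Vis a) n' \<Longrightarrow> step (Par p m n) (Vis a) (Par p m' n')"
| tauL: "step m Tau m' \<Longrightarrow> step (Par p m n) Tau (Par p m' n)"
| tauR: "step n Tau n' \<Longrightarrow> step (Par p m n) Tau (Par p m n')"
| "end": "step (Par p (Verdict End) (Verdict End)) Tau (Verdict End)"
| conj_yesL: "step (Par (\<otimes>) (Verdict Yes) m) Tau m"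
| conj_yesR: "step (Par (\<otimes>) m (Verdict Yes)) Tau m"
| conj_noL: "step (Par (\<otimes>) (Verdict No) m) Tau (Verdict No)"
| conj_noR: "step (Par (\<otimes>) m (Verdict No)) Tau (Verdict No)"
| disj_noL: "step (Par (\<oplus>) (Verdict No) m) Tau m"
| disj_noR: "step (Par (\<oplus>) m (Verdict No)) Tau m"
| disj_yesL: "step (Par (\<oplus>) (Verdict Yes) m) Tau (Verdict Yes)"
| disj_yesR: "step (Par (\<oplus>) m (Verdict Yes)) Tau (Verdict Yes)"

inductive weak_step :: "'a mon \<Rightarrow> 'a list \<Rightarrow> 'a mon \<Rightarrow> bool" where
  refl: "weak_step m [] m"
| tau: "step m Tau m' \<Longrightarrow> weak_step m' s n \<Longrightarrow> weak_step m s n"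
| vis: "step m (Vis a) m' \<Longrightarrow> weak_step m' s n \<Longrightarrow> weak_step m (a # s) n"

primrec reaches :: "verdict \<Rightarrow> 'a mon \<Rightarrow> 'a trace \<Rightarrow> bool" where
  "reaches v m (Fin s) \<longleftrightarrow> weak_step m s (Verdict v)"
| "reaches v m (Inf t) \<longleftrightarrow> (\<exists>k. weak_step m (stake k t) (Verdict v))"

definition accepts :: "'a mon \<Rightarrow> 'a trace \<Rightarrow> bool" where
  "accepts m f \<longleftrightarrow> reaches Yes m f"

definition rejects :: "'a mon \<Rightarrow> 'a trace \<Rightarrow> bool" where
  "rejects m f \<longleftrightarrow> reaches No m f"

definition sound :: "'a mon \<Rightarrow> 'a trace set \<Rightarrow> bool" where
  "sound m P \<longleftrightarrow> (\<forall>f. (accepts m f \<longrightarrow> f \<in> P) \<and> (rejects m f \<longrightarrow> f \<notin> P))"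

end

(* A formula defines a trace property with only finitely many left quotients: by guardedness, the
   quotient of (the meaning of) a subformula by an action is a Boolean combination of meanings of
   subformulae that start with a modality, fixpoint variables being interpreted by the fixpoints
   they stand for.  These quotients are the states of a finite deterministic automaton, in which a
   finite trace determines the property positively (negatively) exactly when it leads to the
   quotient UNIV (to the empty quotient).  The monitor is the tree unfolding of this automaton, with
   recursion variables for the back edges and with the two determined states replaced by verdicts. *)
theory Submission
  imports Defs
begin

section \<open>Left quotients of trace properties\<close>

lemma tappend_Nil [simp]: "tappend [] f = f"
  by (cases f) auto

lemma tappend_append: "tappend (s @ t) f = tappend s (tappend t f)"
  by (cases f) auto

lemma tcons_inject [simp]: "tcons a f = tcons b g \<longleftrightarrow> a = b \<and> f = g"
  by (cases f; cases g) auto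

definition quot :: "'a \<Rightarrow> 'a trace set \<Rightarrow> 'a trace set" where
  "quot a S = {f. tcons a f \<in> S}"

lemma quot_simps [simp]:
  "quot a UNIV = UNIV"
  "quot a {} = {}"
  by (auto simp: quot_def)

text \<open>\<open>fold\<close> consumes the head first, and the quotient by the first letter must
  be taken first too; so running the automaton on \<open>s\<close> is
  \<open>fold quot s\<close>.\<close>

lemma fold_quot: "fold quot s S = {f. tappend s f \<in> S}"
proof (induction s arbitrary: S)
  case (Cons a s)
  have "tappend (a # s) f = tcons a (tappend s f)" for f
    using tappend_append[of "[a]" s f] by simp
  then have "{f. tappend s f \<in> quot a S} = {f. tappend (a # s) f \<in> S}"
    by (simp only: quot_def mem_Collect_eq)
  then show ?case by (simp only: fold_simps Cons.IH)
qed simp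

lemma pos_determines_iff_fold_quot: "pos_determines s P \<longleftrightarrow> fold quot s P = UNIV"
  by (auto simp: pos_determines_def fold_quot)

lemma neg_determines_iff_fold_quot: "neg_determines s P \<longleftrightarrow> fold quot s P = {}"
  by (auto simp: neg_determines_def fold_quot)

text \<open>Membership in the Boolean algebra of sets generated by \<open>C\<close>, if \<open>C\<close> is finite.\<close>

definition saturated :: "'b set set \<Rightarrow> 'b set \<Rightarrow> bool" where
  "saturated C S \<longleftrightarrow> (\<forall>f g. (\<forall>c\<in>C. f \<in> c \<longleftrightarrow> g \<in> c) \<longrightarrow> (f \<in> S \<longleftrightarrow> g \<in> S))"

lemma saturated_base: "S \<in> C \<Longrightarrow> saturated C S"
  by (simp add: saturated_def)

lemma saturated_UNIV: "saturated C UNIV"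
  and saturated_empty: "saturated C {}"
  by (simp_all add: saturated_def)

lemma saturated_Un: "saturated C S \<Longrightarrow> saturated C T \<Longrightarrow> saturated C (S \<union> T)"
  and saturated_Int: "saturated C S \<Longrightarrow> saturated C T \<Longrightarrow> saturated C (S \<inter> T)"
  unfolding saturated_def Un_iff Int_iff by meson+

lemma saturated_trans:
  assumes "saturated C S" and "\<And>c. c \<in> C \<Longrightarrow> saturated D c"
  shows "saturated D S"
  unfolding saturated_def
proof (intro allI impI)
  fix f g assume "\<forall>d\<in>D. f \<in> d \<longleftrightarrow> g \<in> d"
  then have "\<forall>c\<in>C. f \<in> c \<longleftrightarrow> g \<in> c"
    using assms(2) by (simp add: saturated_def)
  then show "f \<in> S \<longleftrightarrow> g \<in> S"
    using assms(1) by (simp add: saturated_def)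
qed

lemma saturated_mono: "saturated C S \<Longrightarrow> C \<subseteq> D \<Longrightarrow> saturated D S"
  by (blast intro: saturated_trans saturated_base)

text \<open>A saturated \<open>S\<close> is a union of atoms, and an atom is named by the members of
  \<open>C\<close> that contain it; so a set of subsets of \<open>C\<close> encodes
  \<open>S\<close>.\<close>

lemma finite_saturated:
  assumes "finite C"
  shows "finite {S. saturated C S}"
proof (rule finite_subset)
  show "{S. saturated C S} \<subseteq> (\<lambda>T. {f. {c \<in> C. f \<in> c} \<in> T}) ` Pow (Pow C)"
  proof
    fix S assume "S \<in> {S. saturated C S}"
    then have S: "saturated C S" by simp
    define T where "T = (\<lambda>f. {c \<in> C. f \<in> c}) ` S"
    have "S = {f. {c \<in> C. f \<in> c} \<in> T}"
    proof
      show "S \<subseteq> {f. {c \<in> C. f \<in> c} \<in> T}" by (auto simp: T_def)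
      show "{f. {c \<in> C. f \<in> c} \<in> T} \<subseteq> S"
      proof
        fix f assume "f \<in> {f. {c \<in> C. f \<in> c} \<in> T}"
        then obtain g where "g \<in> S" "{c \<in> C. f \<in> c} = {c \<in> C. g \<in> c}" by (auto simp: T_def)
        then show "f \<in> S" using S unfolding saturated_def by blast
      qed
    qed
    moreover have "T \<in> Pow (Pow C)" by (auto simp: T_def)
    ultimately show "S \<in> (\<lambda>T. {f. {c \<in> C. f \<in> c} \<in> T}) ` Pow (Pow C)" by blast
  qed
qed (simp add: assms)

text \<open>If no \<open>quot a c\<close> separates \<open>f\<close> from \<open>g\<close>, then no
  member of \<open>C\<close> separates \<open>tcons a f\<close> from \<open>tcons a g\<close>. So it
  is enough to check generators.\<close>

lemma saturated_quot:
  assumes "\<And>c. c \<in> C \<Longrightarrow> saturated C (quot a c)" and "saturated C S"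
  shows "saturated C (quot a S)"
  unfolding saturated_def
proof (intro allI impI)
  fix f g assume fg: "\<forall>c\<in>C. f \<in> c \<longleftrightarrow> g \<in> c"
  have "tcons a f \<in> c \<longleftrightarrow> tcons a g \<in> c" if "c \<in> C" for c
    using assms(1)[OF that] fg unfolding saturated_def quot_def by blast
  then show "f \<in> quot a S \<longleftrightarrow> g \<in> quot a S"
    using assms(2) unfolding saturated_def quot_def by blast
qed

section \<open>Monotonicity, fixpoint unfolding and quotients of the semantics\<close>

lemma sem_mono: "(\<And>X. \<sigma> X \<subseteq> \<rho> X) \<Longrightarrow> sem \<phi> \<sigma> \<subseteq> sem \<phi> \<rho>"
proof (induction \<phi> arbitrary: \<sigma> \<rho>)
  case (Or \<phi> \<psi>)
  have "sem \<phi> \<sigma> \<subseteq> sem \<phi> \<rho>" "sem \<psi> \<sigma> \<subseteq> sem \<psi> \<rho>" by ((rule Or.IH, rule Or.prems)+)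
  then show ?case by auto
next
  case (And \<phi> \<psi>)
  have "sem \<phi> \<sigma> \<subseteq> sem \<phi> \<rho>" "sem \<psi> \<sigma> \<subseteq> sem \<psi> \<rho>" by ((rule And.IH, rule And.prems)+)
  then show ?case by auto
next
  case (Dia a \<phi>)
  have "sem \<phi> \<sigma> \<subseteq> sem \<phi> \<rho>" by (rule Dia.IH, rule Dia.prems)
  then show ?case by auto
next
  case (Box a \<phi>)
  have "sem \<phi> \<sigma> \<subseteq> sem \<phi> \<rho>" by (rule Box.IH, rule Box.prems)
  then show ?case by auto
next
  case (Min X \<phi>)
  have "sem \<phi> (\<sigma>(X := S)) \<subseteq> sem \<phi> (\<rho>(X := S))" for S
    by (rule Min.IH) (simp add: Min.prems)
  then show ?case unfolding sem.simps by (intro Inter_anti_mono) blast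
next
  case (Max X \<phi>)
  have "sem \<phi> (\<sigma>(X := S)) \<subseteq> sem \<phi> (\<rho>(X := S))" for S
    by (rule Max.IH) (simp add: Max.prems)
  then show ?case unfolding sem.simps by (intro Union_mono) blast
qed simp_all

lemma mono_sem_upd: "mono (\<lambda>S. sem \<phi> (\<sigma>(X := S)))"
  by (rule monoI, rule sem_mono) simp

text \<open>The clauses for \<open>Min\<close> and \<open>Max\<close> are the Knaster-Tarski forms
  of \<open>lfp\<close> and \<open>gfp\<close>.\<close>

lemma sem_Min_unfold: "sem (Min X \<phi>) \<sigma> = sem \<phi> (\<sigma>(X := sem (Min X \<phi>) \<sigma>))"
  using lfp_unfold[OF mono_sem_upd[of \<phi> \<sigma> X]] by (simp add: lfp_def)

lemma sem_Max_unfold: "sem (Max X \<phi>) \<sigma> = sem \<phi> (\<sigma>(X := sem (Max X \<phi>) \<sigma>))"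
  using gfp_unfold[OF mono_sem_upd[of \<phi> \<sigma> X]] by (simp add: gfp_def)

lemma quot_Dia: "quot a (sem (Dia b \<phi>) \<sigma>) = (if a = b then sem \<phi> \<sigma> else {})"
  by (auto simp: quot_def)

lemma quot_Box: "quot a (sem (Box b \<phi>) \<sigma>) = (if a = b then sem \<phi> \<sigma> else UNIV)"
  by (auto simp: quot_def)

lemma unguarded_vars_subset_fv: "unguarded_vars \<phi> \<subseteq> fv \<phi>"
  by (induction \<phi>) auto

section \<open>Finite bases for the quotients of a formula\<close>

text \<open>\<open>C\<close> collects the meanings of the subformulae of \<open>\<phi>\<close> that start with a modality. Quotients of
  the values of \<open>\<sigma>\<close> are not under control, whence the special role of unguarded variables.\<close>

definition quot_basis :: "'a trace set set \<Rightarrow> 'a formula \<Rightarrow> (var \<Rightarrow> 'a trace set) \<Rightarrow> bool" where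
  "quot_basis C \<phi> \<sigma> \<longleftrightarrow> finite C \<and> saturated (C \<union> \<sigma> ` unguarded_vars \<phi>) (sem \<phi> \<sigma>)
     \<and> (\<forall>c\<in>C. \<forall>a. saturated (C \<union> \<sigma> ` fv \<phi>) (quot a c))"

lemma quot_basis_Un:
  assumes "quot_basis C \<phi> \<sigma>" and "quot_basis D \<psi> \<sigma>"
  shows "finite (C \<union> D)"
    and "saturated (C \<union> D \<union> \<sigma> ` (unguarded_vars \<phi> \<union> unguarded_vars \<psi>)) (sem \<phi> \<sigma>)"
    and "saturated (C \<union> D \<union> \<sigma> ` (unguarded_vars \<phi> \<union> unguarded_vars \<psi>)) (sem \<psi> \<sigma>)"
    and "\<forall>c\<in>C \<union> D. \<forall>a. saturated (C \<union> D \<union> \<sigma> ` (fv \<phi> \<union> fv \<psi>)) (quot a c)"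
proof -
  show "finite (C \<union> D)" using assms by (simp add: quot_basis_def)
  show "saturated (C \<union> D \<union> \<sigma> ` (unguarded_vars \<phi> \<union> unguarded_vars \<psi>)) (sem \<phi> \<sigma>)"
    using assms(1) unfolding quot_basis_def by (blast intro: saturated_mono)
  show "saturated (C \<union> D \<union> \<sigma> ` (unguarded_vars \<phi> \<union> unguarded_vars \<psi>)) (sem \<psi> \<sigma>)"
    using assms(2) unfolding quot_basis_def by (blast intro: saturated_mono)
  have "C \<union> \<sigma> ` fv \<phi> \<subseteq> C \<union> D \<union> \<sigma> ` (fv \<phi> \<union> fv \<psi>)" "D \<union> \<sigma> ` fv \<psi> \<subseteq> C \<union> D \<union> \<sigma> ` (fv \<phi> \<union> fv \<psi>)"
    by auto
  then show "\<forall>c\<in>C \<union> D. \<forall>a. saturated (C \<union> D \<union> \<sigma> ` (fv \<phi> \<union> fv \<psi>)) (quot a c)"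
    using assms unfolding quot_basis_def by (meson UnE saturated_mono)
qed

text \<open>The meaning of \<open>\<psi>\<close> becomes a generator itself; its quotients are
  trivial or the meaning of \<open>\<phi>\<close>. Variables unguarded in \<open>\<phi>\<close> thus
  matter only after a quotient, where all of \<open>fv\<close> is available.\<close>

lemma quot_basis_modality:
  assumes "quot_basis C \<phi> \<sigma>" and "fv \<psi> = fv \<phi>"
    and "\<And>a. quot a (sem \<psi> \<sigma>) \<in> {sem \<phi> \<sigma>, UNIV, {}}"
  shows "quot_basis (insert (sem \<psi> \<sigma>) C) \<psi> \<sigma>"
proof -
  let ?D = "insert (sem \<psi> \<sigma>) C \<union> \<sigma> ` fv \<phi>"
  have "saturated ?D (sem \<phi> \<sigma>)"
    using assms(1) unguarded_vars_subset_fv[of \<phi>]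
    unfolding quot_basis_def by (blast intro: saturated_mono)
  then have "saturated ?D (quot a (sem \<psi> \<sigma>))" for a
    using assms(3)[of a] saturated_UNIV saturated_empty by auto
  moreover have "\<forall>c\<in>C. \<forall>a. saturated ?D (quot a c)"
    using assms(1) unfolding quot_basis_def by (blast intro: saturated_mono)
  ultimately show ?thesis
    using assms(1,2) unfolding quot_basis_def by (auto intro: saturated_base)
qed

text \<open>Guardedness keeps \<open>X\<close> out of the generators of the fixpoint, which is
  therefore built from \<open>C\<close> and the other variables. So it can be eliminated as a
  generator of the quotients.\<close>

lemma quot_basis_fixpoint:
  assumes C: "quot_basis C \<phi> (\<sigma>(X := sem \<psi> \<sigma>))"
    and unfold: "sem \<psi> \<sigma> = sem \<phi> (\<sigma>(X := sem \<psi> \<sigma>))"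
    and vars: "X \<notin> unguarded_vars \<phi>" "fv \<psi> = fv \<phi> - {X}" "unguarded_vars \<psi> = unguarded_vars \<phi> - {X}"
  shows "quot_basis C \<psi> \<sigma>"
proof -
  let ?\<rho> = "\<sigma>(X := sem \<psi> \<sigma>)"
  have "?\<rho> ` unguarded_vars \<phi> = \<sigma> ` unguarded_vars \<psi>"
    using vars by (auto simp: image_def)
  then have S: "saturated (C \<union> \<sigma> ` unguarded_vars \<psi>) (sem \<psi> \<sigma>)"
    using C unfold by (simp add: quot_basis_def)
  then have S': "saturated (C \<union> \<sigma> ` fv \<psi>) (sem \<psi> \<sigma>)"
    using unguarded_vars_subset_fv[of \<psi>] by (blast intro: saturated_mono)
  have "saturated (C \<union> \<sigma> ` fv \<psi>) (quot a c)" if "c \<in> C" for a c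
  proof (rule saturated_trans)
    show "saturated (C \<union> ?\<rho> ` fv \<phi>) (quot a c)"
      using C that by (simp add: quot_basis_def)
    show "saturated (C \<union> \<sigma> ` fv \<psi>) d" if "d \<in> C \<union> ?\<rho> ` fv \<phi>" for d
      using that S' vars(2) by (auto intro: saturated_base split: if_splits)
  qed
  with S C show ?thesis by (simp add: quot_basis_def)
qed

text \<open>The valuation is generalised because the body of a fixpoint formula is taken with its
  variable denoting that very fixpoint.\<close>

lemma ex_quot_basis: "guarded \<phi> \<Longrightarrow> \<exists>C. quot_basis C \<phi> \<sigma>"
proof (induction \<phi> arbitrary: \<sigma>)
  case TT
  then show ?case by (intro exI[of _ "{}"]) (simp add: quot_basis_def saturated_UNIV)
next
  case FF
  then show ?case by (intro exI[of _ "{}"]) (simp add: quot_basis_def saturated_empty)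
next
  case (Or \<phi> \<psi>)
  then obtain C D where "quot_basis C \<phi> \<sigma>" "quot_basis D \<psi> \<sigma>" by fastforce
  note quot_basis_Un[OF this]
  then have "quot_basis (C \<union> D) (Or \<phi> \<psi>) \<sigma>"
    unfolding quot_basis_def by (simp only: sem.simps fv.simps unguarded_vars.simps saturated_Un simp_thms)
  then show ?case ..
next
  case (And \<phi> \<psi>)
  then obtain C D where "quot_basis C \<phi> \<sigma>" "quot_basis D \<psi> \<sigma>" by fastforce
  note quot_basis_Un[OF this]
  then have "quot_basis (C \<union> D) (And \<phi> \<psi>) \<sigma>"
    unfolding quot_basis_def by (simp only: sem.simps fv.simps unguarded_vars.simps saturated_Int simp_thms)
  then show ?case ..
next
  case (Dia b \<phi>)
  then obtain C where "quot_basis C \<phi> \<sigma>" by fastforce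
  then have "quot_basis (insert (sem (Dia b \<phi>) \<sigma>) C) (Dia b \<phi>) \<sigma>"
    by (rule quot_basis_modality) (simp_all only: quot_Dia fv.simps, simp)
  then show ?case ..
next
  case (Box b \<phi>)
  then obtain C where "quot_basis C \<phi> \<sigma>" by fastforce
  then have "quot_basis (insert (sem (Box b \<phi>) \<sigma>) C) (Box b \<phi>) \<sigma>"
    by (rule quot_basis_modality) (simp_all only: quot_Box fv.simps, simp)
  then show ?case ..
next
  case (Min X \<phi>)
  then obtain C where "quot_basis C \<phi> (\<sigma>(X := sem (Min X \<phi>) \<sigma>))" by fastforce
  then have "quot_basis C (Min X \<phi>) \<sigma>"
    by (rule quot_basis_fixpoint[OF _ sem_Min_unfold]) (use Min.prems in simp_all)
  then show ?case ..
next
  case (Max X \<phi>)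
  then obtain C where "quot_basis C \<phi> (\<sigma>(X := sem (Max X \<phi>) \<sigma>))" by fastforce
  then have "quot_basis C (Max X \<phi>) \<sigma>"
    by (rule quot_basis_fixpoint[OF _ sem_Max_unfold]) (use Max.prems in simp_all)
  then show ?case ..
next
  case (Var X)
  then show ?case by (intro exI[of _ "{}"]) (simp add: quot_basis_def saturated_base)
qed

lemma ex_finite_quot_closed:
  assumes "closed_formula \<phi>" and "guarded \<phi>"
  obtains Q where "finite Q" "csem \<phi> \<in> Q" "UNIV \<in> Q" "{} \<in> Q" "\<And>a S. S \<in> Q \<Longrightarrow> quot a S \<in> Q"
proof -
  obtain C where C: "quot_basis C \<phi> (\<lambda>_. {})"
    using ex_quot_basis[OF assms(2)] by blast
  have fv: "fv \<phi> = {}" "unguarded_vars \<phi> = {}"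
    using assms(1) unguarded_vars_subset_fv[of \<phi>] by (auto simp: closed_formula_def)
  show ?thesis
  proof
    \<comment> \<open>\<open>Q\<close> is the whole Boolean algebra generated by \<open>C\<close>;
      closedness leaves no values of variables among the generators.\<close>
    show "finite {S. saturated C S}"
      using C by (simp add: quot_basis_def finite_saturated)
    show "csem \<phi> \<in> {S. saturated C S}"
      using C fv by (simp add: quot_basis_def csem_def)
    show "quot a S \<in> {S. saturated C S}" if "S \<in> {S. saturated C S}" for a S
      using that C fv by (auto simp: quot_basis_def intro: saturated_quot)
  qed (simp_all add: saturated_UNIV saturated_empty)
qed

section \<open>Monitors from finite automata\<close>

text \<open>A trailing \<open>End\<close> would loop under every action and add unwanted transitions
  to the sum; hence the clause for one-element lists.\<close>

fun branch :: "'a list \<Rightarrow> ('a \<Rightarrow> 'a mon) \<Rightarrow> 'a mon" where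
  "branch [] F = Verdict End"
| "branch [a] F = Prefix a (F a)"
| "branch (a # b # xs) F = Sum (Prefix a (F a)) (branch (b # xs) F)"

inductive_cases step_PrefixE: "step (Prefix a m) l n"
inductive_cases step_SumE: "step (Sum m n) l k"
inductive_cases step_RecE: "step (Rec x m) l n"
inductive_cases step_VerdictE: "step (Verdict v) l n"

lemma step_branch_iff:
  "xs \<noteq> [] \<Longrightarrow> step (branch xs F) (Vis a) n \<longleftrightarrow> a \<in> set xs \<and> n = F a"
  by (induction xs F rule: branch.induct)
    (auto elim: step_PrefixE step_SumE intro: step.intros)

lemma msubst_branch: "msubst x k (branch xs F) = branch xs (\<lambda>a. msubst x k (F a))"
  by (induction xs F rule: branch.induct) auto

lemma mon_fv_branch: "mon_fv (branch xs F) = (\<Union>a\<in>set xs. mon_fv (F a))"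
  by (induction xs F rule: branch.induct) auto

lemma msubst_fresh: "x \<notin> mon_fv m \<Longrightarrow> msubst x k m = m"
  by (induction m) auto

definition actions :: "'a::finite list" where
  "actions = (SOME xs. set xs = UNIV)"

lemma set_actions [simp]: "set actions = UNIV"
  unfolding actions_def by (rule someI_ex) (simp add: finite_list)

lemma actions_nonempty [simp]: "actions \<noteq> []"
  using set_actions by (metis UNIV_not_empty set_empty)

text \<open>
  The automaton has transition function \<open>\<delta>\<close>, its state \<open>q\<close> is named by the variable \<open>v q\<close>, and
  \<open>\<theta>\<close> holds the monitors of the states that are not to be unfolded any more. The first argument is
  fuel; it suffices if it bounds the number of the other states, so that the \<open>End\<close> is not reached.
\<close>

primrec unfolding_mon ::
  "nat \<Rightarrow> ('a \<Rightarrow> 's \<Rightarrow> 's) \<Rightarrow> ('s \<Rightarrow> var) \<Rightarrow> ('s \<Rightarrow> 'a mon option) \<Rightarrow> 's \<Rightarrow> 'a::finite mon"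
where
  "unfolding_mon 0 \<delta> v \<theta> q = (case \<theta> q of Some m \<Rightarrow> m | None \<Rightarrow> Verdict End)"
| "unfolding_mon (Suc n) \<delta> v \<theta> q = (case \<theta> q of Some m \<Rightarrow> m
     | None \<Rightarrow> Rec (v q) (branch actions (\<lambda>a. unfolding_mon n \<delta> v (\<theta>(q \<mapsto> MVar (v q))) (\<delta> a q))))"

lemma unfolding_mon_Some: "\<theta> q = Some m \<Longrightarrow> unfolding_mon n \<delta> v \<theta> q = m"
  by (cases n) auto

text \<open>Each \<open>MVar (v q)\<close> entered into \<open>\<theta>\<close> is bound by the
  \<open>Rec (v q)\<close> created with it.\<close>

lemma mon_fv_unfolding_mon: "mon_fv (unfolding_mon n \<delta> v \<theta> q) \<subseteq> (\<Union>m\<in>ran \<theta>. mon_fv m)"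
proof (induction n arbitrary: \<theta> q)
  case 0
  then show ?case by (auto split: option.splits intro: ranI)
next
  case (Suc n)
  show ?case
  proof (cases "\<theta> q")
    case None
    have "mon_fv (unfolding_mon n \<delta> v (\<theta>(q \<mapsto> MVar (v q))) (\<delta> a q))
      \<subseteq> insert (v q) (\<Union>m\<in>ran \<theta>. mon_fv m)" for a
      using Suc[of "\<theta>(q \<mapsto> MVar (v q))" "\<delta> a q"] None by (simp del: fun_upd_apply)
    then show ?thesis using None by (fastforce simp: mon_fv_branch)
  qed (auto intro: ranI)
qed

text \<open>States in \<open>dom \<theta>\<close> are not unfolded and names are injective on
  \<open>Q\<close>, so no \<open>Rec\<close> created here binds \<open>v p\<close>. Unrolling a
  \<open>Rec\<close> thereby amounts to updating \<open>\<theta>\<close>.\<close>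

lemma msubst_unfolding_mon:
  assumes "inj_on v Q" and "\<And>a q. q \<in> Q \<Longrightarrow> \<delta> a q \<in> Q"
    and "p \<in> Q" "p \<in> dom \<theta>" "q \<in> Q"
  shows "msubst (v p) k (unfolding_mon n \<delta> v \<theta> q)
    = unfolding_mon n \<delta> v (map_option (msubst (v p) k) \<circ> \<theta>) q"
  using assms(4,5)
proof (induction n arbitrary: \<theta> q)
  case 0
  then show ?case by (simp split: option.splits)
next
  case (Suc n)
  show ?case
  proof (cases "\<theta> q")
    case None
    then have "v q \<noteq> v p"
      using Suc.prems assms(1,3) by (metis domIff inj_on_def)
    moreover from this have "map_option (msubst (v p) k) \<circ> \<theta>(q \<mapsto> MVar (v q))
      = (map_option (msubst (v p) k) \<circ> \<theta>)(q \<mapsto> MVar (v q))"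
      by auto
    ultimately show ?thesis
      using None Suc.prems Suc.IH[of "\<theta>(q \<mapsto> MVar (v q))"] assms(2)
      by (simp add: msubst_branch comp_def del: fun_upd_apply)
  qed simp
qed

section \<open>Correctness of the unfolding\<close>

text \<open>Step-indexed, since the monitor of a state contains itself in place of its back edges.\<close>

primrec tracks :: "nat \<Rightarrow> 'a mon \<Rightarrow> 'a trace set \<Rightarrow> bool" where
  "tracks 0 m S \<longleftrightarrow> True"
| "tracks (Suc k) m S \<longleftrightarrow> (m = Verdict Yes \<longleftrightarrow> S = UNIV) \<and> (m = Verdict No \<longleftrightarrow> S = {})
     \<and> (\<forall>n. \<not> step m Tau n)
     \<and> (\<forall>a. (\<exists>n. step m (Vis a) n) \<and> (\<forall>n. step m (Vis a) n \<longrightarrow> tracks k n (quot a S)))"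

lemma tracks_Suc_D: "tracks (Suc k) m S \<Longrightarrow> tracks k m S"
proof (induction k arbitrary: m S)
  case (Suc k)
  note m = iffD1[OF tracks.simps(2)[of "Suc k"] Suc.prems]
  then have "tracks k n (quot a S)" if "step m (Vis a) n" for a n
    using that by (intro Suc.IH) blast
  with m show ?case unfolding tracks.simps(2)[of k] by blast
qed simp

lemma tracks_Yes: "tracks k (Verdict Yes) UNIV"
  by (induction k) (auto elim: step_VerdictE intro: step.intros)

lemma tracks_No: "tracks k (Verdict No) {}"
  by (induction k) (auto elim: step_VerdictE intro: step.intros)

text \<open>After unrolling, the successor is an unfolding with one more resolved state,
  \<open>S\<close> with its own monitor. Induction on fuel applies to it once that monitor is known
  to track \<open>S\<close>, which a second induction, on depth, supplies.\<close>

lemma tracks_unfolding_mon: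
  assumes Q: "finite Q" "inj_on v Q" "\<And>a S. S \<in> Q \<Longrightarrow> quot a S \<in> Q"
    and "dom \<theta> \<subseteq> Q" "UNIV \<in> dom \<theta>" "{} \<in> dom \<theta>" "card (Q - dom \<theta>) \<le> n" "S \<in> Q"
    and "\<And>T m. \<theta> T = Some m \<Longrightarrow> mon_fv m = {} \<and> tracks k m T"
  shows "tracks k (unfolding_mon n quot v \<theta> S) S"
  using assms(4-)
proof (induction n arbitrary: k \<theta> S)
  case 0
  then have "S \<in> dom \<theta>" using Q(1) by auto
  then show ?case using 0 by auto
next
  case (Suc n)
  note IH = Suc.IH
  show ?case
  proof (cases "\<theta> S")
    case None
    define R where "R = unfolding_mon (Suc n) quot v \<theta> S"
    let ?body = "branch actions (\<lambda>a. unfolding_mon n quot v (\<theta>(S \<mapsto> MVar (v S))) (quot a S))"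
    have R: "R = Rec (v S) ?body"
      using None by (simp add: R_def)
    have closed: "mon_fv m = {}" if "\<theta> T = Some m" for T m
      using Suc.prems(6)[OF that] by simp
    then have R_closed: "mon_fv R = {}"
      using mon_fv_unfolding_mon[of "Suc n" quot v \<theta> S] unfolding R_def ran_def by fastforce
    \<comment> \<open>The entries of \<open>\<theta>\<close> are closed, so the substitution changes
      only the placeholder for \<open>S\<close>.\<close>
    have "map_option (msubst (v S) R) \<circ> \<theta>(S \<mapsto> MVar (v S)) = \<theta>(S \<mapsto> R)"
    proof
      fix T
      show "(map_option (msubst (v S) R) \<circ> \<theta>(S \<mapsto> MVar (v S))) T = (\<theta>(S \<mapsto> R)) T"
        using closed[of T] by (cases "\<theta> T") (auto simp: msubst_fresh)
    qed
    then have "msubst (v S) R ?body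
      = branch actions (\<lambda>a. unfolding_mon n quot v (\<theta>(S \<mapsto> R)) (quot a S))"
      using Q(2,3) Suc.prems(5) by (simp add: msubst_branch msubst_unfolding_mon[of v Q])
    then have step_R: "step R (Vis a) m \<longleftrightarrow> m = unfolding_mon n quot v (\<theta>(S \<mapsto> R)) (quot a S)" for a m
      unfolding R by (auto simp: step_branch_iff elim!: step_RecE intro!: step.rec)
    have card: "card (Q - dom (\<theta>(S \<mapsto> R))) \<le> n"
    proof -
      have "Q - dom (\<theta>(S \<mapsto> R)) = (Q - dom \<theta>) - {S}" by auto
      moreover have "S \<in> Q - dom \<theta>" using None Suc.prems(5) by auto
      ultimately show ?thesis
        using Suc.prems(4) Q(1) by (simp add: card_Diff_singleton)
    qed
    \<comment> \<open>The successors of \<open>R\<close> contain \<open>R\<close> again, but need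
      one unit of depth less; induction on depth breaks the circularity.\<close>
    have "(\<And>T m. \<theta> T = Some m \<Longrightarrow> tracks k m T) \<Longrightarrow> tracks k R S"
    proof (induction k)
      case (Suc k)
      have \<theta>: "tracks k m T" if "\<theta> T = Some m" for T m
        using Suc.prems[OF that] by (rule tracks_Suc_D)
      have R_k: "tracks k R S" using \<theta> by (rule Suc.IH)
      have next_state: "tracks k (unfolding_mon n quot v (\<theta>(S \<mapsto> R)) (quot a S)) (quot a S)" for a
      proof (rule IH[OF _ _ _ card])
        show "mon_fv m = {} \<and> tracks k m T" if "(\<theta>(S \<mapsto> R)) T = Some m" for T m
          using that \<theta> closed R_closed R_k by (auto split: if_splits)
      qed (use \<open>S \<in> Q\<close> \<open>dom \<theta> \<subseteq> Q\<close> \<open>UNIV \<in> dom \<theta>\<close> \<open>{} \<in> dom \<theta>\<close> Q(3) in \<open>auto simp del: fun_upd_apply\<close>)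
      have "S \<noteq> UNIV" "S \<noteq> {}"
        using None \<open>UNIV \<in> dom \<theta>\<close> \<open>{} \<in> dom \<theta>\<close> by auto
      moreover have "R \<noteq> Verdict u" "\<not> step R Tau m" for u m
        unfolding R by (auto elim: step_RecE)
      ultimately show ?case
        using next_state by (simp add: step_R)
    qed simp
    then show ?thesis
      using Suc.prems(6) unfolding R_def by blast
  qed (use Suc.prems in \<open>auto simp: unfolding_mon_Some\<close>)
qed

text \<open>A visible step costs one unit of depth and \<open>Tau\<close> steps are excluded; a unit
  remains so that the verdict can be read off at \<open>n\<close>.\<close>

lemma tracks_weak_step:
  "weak_step m s n \<Longrightarrow> tracks (Suc (k + length s)) m S \<Longrightarrow> tracks (Suc k) n (fold quot s S)"
proof (induction arbitrary: S rule: weak_step.induct)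
  case (tau m m' s n)
  then show ?case unfolding tracks.simps by blast
next
  case (vis m a m' s n)
  have "tracks (Suc (Suc (k + length s))) m S"
    using vis.prems by simp
  then have "tracks (Suc (k + length s)) m' (quot a S)"
    using vis.hyps(1) unfolding tracks.simps(2)[of "Suc (k + length s)"] by blast
  then show ?case using vis.IH by (simp only: fold_simps)
qed simp

lemma tracks_ex_weak_step: "tracks (length s) m S \<Longrightarrow> \<exists>n. weak_step m s n"
proof (induction s arbitrary: m S)
  case (Cons a s)
  then have "\<exists>n. step m (Vis a) n" "\<And>n. step m (Vis a) n \<Longrightarrow> tracks (length s) n (quot a S)"
    by simp_all
  then obtain n where "step m (Vis a) n" "tracks (length s) n (quot a S)" by blast
  with Cons.IH show ?case by (blast intro: weak_step.vis)
qed (blast intro: weak_step.refl)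

text \<open>Every run over \<open>s\<close> ends with the right verdict status, and a run exists
  because tracking monitors never block; the latter gives the direction from quotients to
  verdicts.\<close>

lemma tracks_weak_step_verdict_iff:
  assumes "\<And>k. tracks k m S"
  shows "weak_step m s (Verdict Yes) \<longleftrightarrow> fold quot s S = UNIV"
    and "weak_step m s (Verdict No) \<longleftrightarrow> fold quot s S = {}"
proof -
  have *: "(n = Verdict Yes \<longleftrightarrow> fold quot s S = UNIV) \<and> (n = Verdict No \<longleftrightarrow> fold quot s S = {})"
    if "weak_step m s n" for n
    using tracks_weak_step[OF that assms, of 0] by simp
  moreover obtain n where "weak_step m s n"
    using tracks_ex_weak_step[OF assms] by blast
  ultimately show "weak_step m s (Verdict Yes) \<longleftrightarrow> fold quot s S = UNIV"
    and "weak_step m s (Verdict No) \<longleftrightarrow> fold quot s S = {}"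
    by blast+
qed

lemma ex_mon_of_finite_quot_closed:
  fixes P :: "'a::finite trace set"
  assumes "finite Q" "P \<in> Q" "UNIV \<in> Q" "{} \<in> Q" "\<And>a S. S \<in> Q \<Longrightarrow> quot a S \<in> Q"
  obtains m where "m \<in> Mon"
    "\<And>s. weak_step m s (Verdict Yes) \<longleftrightarrow> pos_determines s P"
    "\<And>s. weak_step m s (Verdict No) \<longleftrightarrow> neg_determines s P"
proof -
  obtain v :: "'a trace set \<Rightarrow> nat" where v: "inj_on v Q"
    using finite_imp_inj_to_nat_seg[OF assms(1)] by blast
  \<comment> \<open>Only the two determined states are resolved in advance; \<open>card Q\<close> is
    enough fuel for all others.\<close>
  define \<theta> :: "'a trace set \<Rightarrow> 'a mon option"
    where "\<theta> = [UNIV \<mapsto> Verdict Yes, {} \<mapsto> Verdict No]"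
  define m where "m = unfolding_mon (card Q) quot v \<theta> P"
  have \<theta>: "mon_fv n = {} \<and> tracks k n T" if "\<theta> T = Some n" for T n k
    using that by (auto simp: \<theta>_def tracks_Yes tracks_No split: if_splits)
  have dom: "dom \<theta> \<subseteq> Q" "UNIV \<in> dom \<theta>" "{} \<in> dom \<theta>"
    using assms(3,4) by (auto simp: \<theta>_def)
  have card: "card (Q - dom \<theta>) \<le> card Q"
    using assms(1) by (simp add: card_mono)
  have "tracks k m P" for k
    unfolding m_def by (rule tracks_unfolding_mon[OF assms(1) v assms(5) dom card assms(2) \<theta>])
  note tracks_weak_step_verdict_iff[OF this]
  moreover have "m \<in> Mon"
    using mon_fv_unfolding_mon[of "card Q" quot v \<theta> P] \<theta>
    unfolding m_def Mon_def ran_def by fastforce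
  ultimately show ?thesis
    by (intro that) (simp_all add: pos_determines_iff_fold_quot neg_determines_iff_fold_quot)
qed

lemma reachesE:
  assumes "reaches v m f"
  obtains s g where "weak_step m s (Verdict v)" "f = tappend s g"
proof (cases f)
  case (Fin s)
  then show ?thesis using assms that[of s "Fin []"] by simp
next
  case (Inf t)
  then obtain k where "weak_step m (stake k t) (Verdict v)" using assms by auto
  then show ?thesis using Inf that[of "stake k t" "Inf (sdrop k t)"] by (simp add: stake_sdrop)
qed

theorem theorem2:
  fixes \<phi> :: "'a::finite formula"
  assumes "closed_formula \<phi>"
    and "guarded \<phi>"
  shows "\<exists>m\<in>Mon. sound m (csem \<phi>)
    \<and> (\<forall>s. pos_determines s (csem \<phi>) \<longrightarrow> accepts m (Fin s))
    \<and> (\<forall>s. neg_determines s (csem \<phi>) \<longrightarrow> rejects m (Fin s))"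
proof -
  obtain Q where Q: "finite Q" "csem \<phi> \<in> Q" "UNIV \<in> Q" "{} \<in> Q" "\<And>a S. S \<in> Q \<Longrightarrow> quot a S \<in> Q"
    by (rule ex_finite_quot_closed[OF assms]) (rule that)
  obtain m where m: "m \<in> Mon"
    "\<And>s. weak_step m s (Verdict Yes) \<longleftrightarrow> pos_determines s (csem \<phi>)"
    "\<And>s. weak_step m s (Verdict No) \<longleftrightarrow> neg_determines s (csem \<phi>)"
    using ex_mon_of_finite_quot_closed[OF Q] by blast
  \<comment> \<open>A verdict on \<open>f\<close> is reached at a prefix of \<open>f\<close> that
    determines the property, which settles the membership of \<open>f\<close>.\<close>
  have "sound m (csem \<phi>)"
    unfolding sound_def accepts_def rejects_def
  proof (intro allI conjI impI)
    fix f
    show "f \<in> csem \<phi>" if "reaches Yes m f"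
      using that by (rule reachesE) (simp add: m(2) pos_determines_def)
    show "f \<notin> csem \<phi>" if "reaches No m f"
      using that by (rule reachesE) (simp add: m(3) neg_determines_def)
  qed
  then show ?thesis
    using m by (intro bexI[of _ m]) (simp_all add: accepts_def rejects_def)
qed

end
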